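(* Let a static topological black hole metric in $d+2$ dimensions (as in the context) satisfy the vacuum Einstein equations $R_{\mu\nu}-\frac12g_{\mu\nu}R+\Lambda g_{\mu\nu}=0$ with $\Lambda=-d(d+1)/2$. Then the pole-skipping data of a massless scalar at orders $n=1,2$ satisfy $$E_1(\mu)=-\frac d2\big[1+d+(d-1)\kappa\big],\qquad E_2(\mu)=-2(d+1)(d-\kappa+d\kappa),$$ $$E_2(\mu^2)=d(d^2-1)(1+\kappa)(1+d-\kappa+d\kappa).$$
   Context: Metric: $ds^2=\frac1{z^2}\big(-f_1(z)dt^2+\frac{dz^2}{f_2(z)}+d\Sigma_\kappa^2\big)$ in $d+2$ dimensions, where $d\Sigma_\kappa^2$ is the metric of the $d$-dimensional plane, unit sphere or unit hyperbolic space for $\kappa=0,1,-1$. The horizon is at $z=1$; $f_1,f_2$ are analytic near $z=1$, $f_1(1)=f_2(1)=0$, $f_1'(1)f_2'(1)=(4\pi T)^2$ with $T>0$ the Hawking temperature. A massless scalar $\Phi=e^{-i\omega t}\psi(z)Y(X)$ with $\Delta_\Sigma Y=-\mu Y$ satisfies $A\psi''+B\psi'+C\psi=0$ with $A=f_1f_2$, $B=\frac12(f_1f_2)'-\frac{d}{z}f_1f_2$, $C=\omega^2-\mu f_1$, where $\mu$ is treated as a complex variable. Write $A_j,B_j,C_j$ for the coefficients of $(z-1)^j$ (zero for $j<0$). Put $\rho=-i\omega/(4\pi T)$ (ingoing exponent) and $$M_{KS}=A_{K-S+3}(\rho+S-1)(\rho+S-2)+B_{K-S+2}(\rho+S-1)+C_{K-S+1},$$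 the coefficient of $\phi_{S-1}$ at order $(z-1)^{\rho+K}$ when $\psi=(z-1)^\rho\sum_j\phi_j(z-1)^j$ is inserted. At $\omega=\omega_n=-2\pi iTn$ (so $\rho=-n/2$), $\det(M_{KS})_{1\le K,S\le n}$ is a polynomial of degree $n$ in $\mu$; its roots $\mu_{n1},\dots,\mu_{nn}$ (with multiplicity) are the order-$n$ pole-skipping values, and $E_n(\mu^l)$ is their elementary symmetric polynomial of degree $l$. *)

theory Defs
  imports
    "HOL-Analysis.Analysis"
    "HOL-Computational_Algebra.Polynomial"
    "Jordan_Normal_Form.Determinant"
begin

no_notation vec_index (infixl \<open>$\<close> 100)

section \<open>Curvature of a metric in a coordinate chart\<close>

definition pderivative :: "'n::finite \<Rightarrow> (real^'n \<Rightarrow> real) \<Rightarrow> real^'n \<Rightarrow> real" where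
  "pderivative i F x = deriv (\<lambda>s. F (x + s *\<^sub>R axis i 1)) 0"

definition christoffel ::
    "(real^'n \<Rightarrow> real^'n^'n) \<Rightarrow> 'n::finite \<Rightarrow> 'n \<Rightarrow> 'n \<Rightarrow> real^'n \<Rightarrow> real" where
  "christoffel g a b c x = (1/2) * (\<Sum>e\<in>UNIV. matrix_inv (g x) $ a $ e *
     (pderivative b (\<lambda>y. g y $ e $ c) x + pderivative c (\<lambda>y. g y $ e $ b) x
        - pderivative e (\<lambda>y. g y $ b $ c) x))"

text \<open>The component $R^a{}_{bcd}$ of the Riemann tensor; with this sign convention and the
  contraction below, round spheres have positive Ricci curvature.\<close>

definition riemann ::
    "(real^'n \<Rightarrow> real^'n^'n) \<Rightarrow> 'n::finite \<Rightarrow> 'n \<Rightarrow> 'n \<Rightarrow> 'n \<Rightarrow> real^'n \<Rightarrow> real" where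
  "riemann g a b c d x =
     pderivative c (christoffel g a d b) x - pderivative d (christoffel g a c b) x
     + (\<Sum>e\<in>UNIV. christoffel g a c e x * christoffel g e d b x
                   - christoffel g a d e x * christoffel g e c b x)"

definition ricci :: "(real^'n \<Rightarrow> real^'n^'n) \<Rightarrow> 'n::finite \<Rightarrow> 'n \<Rightarrow> real^'n \<Rightarrow> real" where
  "ricci g b d x = (\<Sum>a\<in>UNIV. riemann g a b a d x)"

definition scalar_curvature :: "(real^'n \<Rightarrow> real^'n^'n) \<Rightarrow> real^'n::finite \<Rightarrow> real" where
  "scalar_curvature g x = (\<Sum>a\<in>UNIV. \<Sum>b\<in>UNIV. matrix_inv (g x) $ a $ b * ricci g a b x)"

definition vacuum_einstein_at ::
    "(real^'n \<Rightarrow> real^'n^'n) \<Rightarrow> real \<Rightarrow> real^'n::finite \<Rightarrow> bool" where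
  "vacuum_einstein_at g \<Lambda> x \<longleftrightarrow>
     (\<forall>a b. ricci g a b x - (1/2) * g x $ a $ b * scalar_curvature g x + \<Lambda> * g x $ a $ b = 0)"


section \<open>The static topological black hole metric\<close>

datatype 'd coord = Time | Radial | Transverse 'd

lemma UNIV_coord: "(UNIV :: 'd coord set) = insert Time (insert Radial (range Transverse))"
  by (auto intro: coord.exhaust)

instance coord :: (finite) finite
  by standard (simp add: UNIV_coord)

lemma card_coord: "CARD('d::finite coord) = CARD('d) + 2"
  unfolding UNIV_coord
  by (subst card_insert_disjoint, auto)+ (auto simp: card_image inj_def)

definition transverse :: "real^('d::finite coord) \<Rightarrow> real^'d" where
  "transverse x = (\<chi> i. x $ Transverse i)"

text \<open>The metric $d\Sigma_\kappa^2$ of the $d$-dimensional plane, unit sphere, unit hyperbolic space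
  ($\kappa = 0, 1, -1$) is written in stereographic coordinates:
  $d\Sigma_\kappa^2 = |dX|^2 / (1 + \kappa |X|^2/4)^2$.  The chart is all of $R^d$ for
  $\kappa = 0$ (Cartesian coordinates) and for $\kappa = 1$ (the sphere without one point), and the
  ball $|X| < 2$ (Poincare ball model) for $\kappa = -1$.\<close>

definition sigma_chart :: "real \<Rightarrow> (real^'d::finite) set" where
  "sigma_chart \<kappa> = {X. 1 + \<kappa> * (norm X)\<^sup>2 / 4 > 0}"

definition sigma_metric :: "real \<Rightarrow> real^'d \<Rightarrow> real^'d^'d::finite" where
  "sigma_metric \<kappa> X = (\<chi> i j. if i = j then 1 / (1 + \<kappa> * (norm X)\<^sup>2 / 4)\<^sup>2 else 0)"

definition bh_metric ::
    "real \<Rightarrow> (real \<Rightarrow> real) \<Rightarrow> (real \<Rightarrow> real) \<Rightarrow>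
     real^('d::finite coord) \<Rightarrow> real^('d coord)^('d coord)" where
  "bh_metric \<kappa> f1 f2 x = (let z = x $ Radial in
     \<chi> a b. (1 / z\<^sup>2) *
       (case (a, b) of
          (Time, Time) \<Rightarrow> - f1 z
        | (Radial, Radial) \<Rightarrow> 1 / f2 z
        | (Transverse i, Transverse j) \<Rightarrow> sigma_metric \<kappa> (transverse x) $ i $ j
        | _ \<Rightarrow> 0))"

definition real_analytic_at :: "(real \<Rightarrow> real) \<Rightarrow> real \<Rightarrow> bool" where
  "real_analytic_at f x0 \<longleftrightarrow>
     (\<exists>r>0. \<exists>a. \<forall>x. \<bar>x - x0\<bar> < r \<longrightarrow> (\<lambda>n. a n * (x - x0) ^ n) sums f x)"


section \<open>Pole-skipping data of the massless scalar\<close>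

definition scalar_A :: "(real \<Rightarrow> real) \<Rightarrow> (real \<Rightarrow> real) \<Rightarrow> real \<Rightarrow> complex" where
  "scalar_A f1 f2 z = of_real (f1 z * f2 z)"

definition scalar_B :: "nat \<Rightarrow> (real \<Rightarrow> real) \<Rightarrow> (real \<Rightarrow> real) \<Rightarrow> real \<Rightarrow> complex" where
  "scalar_B d f1 f2 z =
     of_real ((1/2) * deriv (\<lambda>y. f1 y * f2 y) z - real d / z * (f1 z * f2 z))"

definition scalar_C :: "(real \<Rightarrow> real) \<Rightarrow> complex \<Rightarrow> complex \<Rightarrow> real \<Rightarrow> complex" where
  "scalar_C f1 \<omega> \<mu> z = \<omega>\<^sup>2 - \<mu> * of_real (f1 z)"

text \<open>Coefficient of $(z-1)^j$ in the Taylor expansion at the horizon.\<close>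

definition horizon_coeff :: "(real \<Rightarrow> complex) \<Rightarrow> int \<Rightarrow> complex" where
  "horizon_coeff F j =
     (if j < 0 then 0
      else (((\<lambda>G z. vector_derivative G (at z)) ^^ nat j) F 1) / fact (nat j))"

definition ps_entry ::
    "nat \<Rightarrow> (real \<Rightarrow> real) \<Rightarrow> (real \<Rightarrow> real) \<Rightarrow> real \<Rightarrow> complex \<Rightarrow> complex \<Rightarrow> nat \<Rightarrow> nat \<Rightarrow> complex" where
  "ps_entry d f1 f2 T \<omega> \<mu> K S =
     (let \<rho> = - \<i> * \<omega> / of_real (4 * pi * T);
          j = int K - int S;
          s = of_nat S
      in horizon_coeff (scalar_A f1 f2) (j + 3) * (\<rho> + s - 1) * (\<rho> + s - 2)
         + horizon_coeff (scalar_B d f1 f2) (j + 2) * (\<rho> + s - 1)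
         + horizon_coeff (scalar_C f1 \<omega> \<mu>) (j + 1))"

definition ps_frequency :: "real \<Rightarrow> nat \<Rightarrow> complex" where
  "ps_frequency T n = - 2 * of_real pi * \<i> * of_real T * of_nat n"

text \<open>Matrices are indexed from 0, hence the shift in \<open>K\<close> and \<open>S\<close>.\<close>

definition ps_determinant ::
    "nat \<Rightarrow> (real \<Rightarrow> real) \<Rightarrow> (real \<Rightarrow> real) \<Rightarrow> real \<Rightarrow> nat \<Rightarrow> complex \<Rightarrow> complex" where
  "ps_determinant d f1 f2 T n \<mu> =
     Determinant.det (Matrix.mat n n (\<lambda>(k, s).
       ps_entry d f1 f2 T (ps_frequency T n) \<mu> (k + 1) (s + 1)))"

definition ps_polynomial ::
    "nat \<Rightarrow> (real \<Rightarrow> real) \<Rightarrow> (real \<Rightarrow> real) \<Rightarrow> real \<Rightarrow> nat \<Rightarrow> complex poly" where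
  "ps_polynomial d f1 f2 T n = (THE p. \<forall>\<mu>. poly p \<mu> = ps_determinant d f1 f2 T n \<mu>)"

definition ps_values ::
    "nat \<Rightarrow> (real \<Rightarrow> real) \<Rightarrow> (real \<Rightarrow> real) \<Rightarrow> real \<Rightarrow> nat \<Rightarrow> complex multiset" where
  "ps_values d f1 f2 T n = proots (ps_polynomial d f1 f2 T n)"

text \<open>Elementary symmetric polynomial of degree \<open>l\<close> of the elements of a multiset: the copies of an
  element \<open>x\<close> are told apart by tags \<open>(x, i)\<close> with \<open>i < count M x\<close>.\<close>

definition esym :: "nat \<Rightarrow> 'a::comm_ring_1 multiset \<Rightarrow> 'a" where
  "esym l M = (\<Sum>I | I \<subseteq> {(x, i). i < count M x} \<and> card I = l. \<Prod>(x, i)\<in>I. x)"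

end

(* At the points with vanishing transverse coordinates the vacuum equations become
   R_ab = -(d+1) g_ab.  The combination of the tt and zz equations gives f1' f2 = f1 f2', the
   transverse one then z f2' = (d+1) (f2 - 1) - (d-1) kappa z^2, both on a left neighbourhood of the
   horizon.  By analyticity all derivatives of these identities hold at z = 1, which fixes the Taylor
   coefficients of f2 up to third order and those of f1 up to a common factor c.  The determinants of
   order 1 and 2 are then explicit polynomials in mu, c drops out of their normalised coefficients,
   and Vieta's formulas give the symmetric polynomials. *)

theory Submission
  imports Defs "HOL-Computational_Algebra.Fundamental_Theorem_Algebra"
begin

section \<open>Diagonal metrics\<close>

text \<open>The metric degenerates at z = 1, where f2 vanishes, so the field equations are only
  usable beside the horizon. Cleared of denominators, the two differential equations survive the
  passage to z = 1, and continuity of the derivatives is enough to reach it. Restricting to X = 0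
  keeps the algebra small, but the Riemann tensor differentiates the Christoffel symbols, which must
  therefore be known on an open set around such a point. Third derivatives appear because the
  order-2 matrix reaches the coefficient A_4 of A = f1 f2, and both factors vanish at z = 1. The
  temperature enters through (4 pi T)^2 = f1'(1) f2'(1), which turns omega_n^2 into a Taylor datum
  as well. The factor c reflects the freedom to rescale t: this multiplies f1 and omega^2 by the
  same constant and leaves mu alone, so the roots cannot depend on it.\<close>

lemma pderivative_eqI:
  assumes "((\<lambda>s. F (x + s *\<^sub>R axis i 1)) has_real_derivative D) (at 0)"
  shows "pderivative i F x = D"
  using assms unfolding pderivative_def by (rule DERIV_imp_deriv)

lemma pderivative_const [simp]: "pderivative i (\<lambda>x. c) x = 0"
  by (rule pderivative_eqI) simp

lemma pderivative_cong:
  assumes "\<forall>\<^sub>F y in nhds x. F y = H y"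
  shows "pderivative i F x = pderivative i H x"
proof -
  have "((\<lambda>s::real. x + s *\<^sub>R axis i 1) \<longlongrightarrow> x + 0 *\<^sub>R axis i 1) (nhds 0)"
    by (intro tendsto_intros) (auto simp: filterlim_ident)
  then have "filterlim (\<lambda>s::real. x + s *\<^sub>R axis i 1) (nhds x) (nhds 0)"
    by simp
  then have "\<forall>\<^sub>F s in nhds (0::real). F (x + s *\<^sub>R axis i 1) = H (x + s *\<^sub>R axis i 1)"
    by (rule eventually_compose_filterlim[OF assms])
  then show ?thesis
    unfolding pderivative_def by (rule deriv_cong_ev) simp
qed

definition diag_metric :: "('n::finite \<Rightarrow> real^'n \<Rightarrow> real) \<Rightarrow> real^'n \<Rightarrow> real^'n^'n" where
  "diag_metric h x = (\<chi> a b. if a = b then h a x else 0)"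

lemma diag_metric_nth: "diag_metric h x $ a $ b = (if a = b then h a x else 0)"
  by (simp add: diag_metric_def)

text \<open>\<open>matrix_inv\<close> is defined by choice, so the reciprocal diagonal
  \<open>M\<close> first shows that a two-sided inverse exists; multiplying the chosen one by
  \<open>M\<close> from the left then identifies the two.\<close>

lemma matrix_inv_diag_metric:
  assumes "\<And>a. h a x \<noteq> 0"
  shows "matrix_inv (diag_metric h x) $ a $ b = (if a = b then 1 / h a x else 0)"
proof -
  define M where "M = (\<chi> a b. if a = b then 1 / h a x else 0)"
  have eq: "diag_metric h x ** M = Finite_Cartesian_Product.mat 1" "M ** diag_metric h x = Finite_Cartesian_Product.mat 1"
    using assms
    by (simp_all add: Finite_Cartesian_Product.vec_eq_iff matrix_matrix_mult_def diag_metric_def M_def Finite_Cartesian_Product.mat_def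
        if_distrib[where f = "\<lambda>y. y * _"] cong: if_cong)
  then have "diag_metric h x ** matrix_inv (diag_metric h x) = Finite_Cartesian_Product.mat 1"
    unfolding matrix_inv_def by (rule someI2[where a = M, OF conjI]) blast
  then have "M ** (diag_metric h x ** matrix_inv (diag_metric h x)) = M"
    by simp
  then have "matrix_inv (diag_metric h x) = M"
    by (simp add: matrix_mul_assoc eq)
  then show ?thesis by (simp add: M_def)
qed

lemma christoffel_diag_metric:
  assumes "\<And>a. h a x \<noteq> 0"
  shows "christoffel (diag_metric h) a b c x =
    ((if a = c then pderivative b (h a) x else 0) + (if a = b then pderivative c (h a) x else 0)
      - (if b = c then pderivative a (h b) x else 0)) / (2 * h a x)"
proof -
  have pd: "pderivative i (\<lambda>y. diag_metric h y $ a $ b) x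
      = (if a = b then pderivative i (h a) x else 0)" for i a b
    by (auto simp: diag_metric_nth)
  show ?thesis
    unfolding christoffel_def pd matrix_inv_diag_metric[where h = h, OF assms]
    by (simp add: if_distrib[where f = "\<lambda>y. y * _"] cong: if_cong) 
qed

text \<open>Contracting the field equations with the inverse metric yields a linear equation for the
  scalar curvature, which is then eliminated. The factor n - 2 stays on the left to avoid dividing
  by it, and invertibility of the metric enters through \<open>trace\<close>.\<close>

lemma vacuum_einstein_at_imp_ricci:
  fixes g :: "real^'n \<Rightarrow> real^'n^'n::finite"
  assumes "vacuum_einstein_at g \<Lambda> x"
    and trace: "(\<Sum>a\<in>UNIV. \<Sum>b\<in>UNIV. matrix_inv (g x) $ a $ b * g x $ a $ b) = real CARD('n)"
  shows "(real CARD('n) - 2) * ricci g a b x = 2 * \<Lambda> * g x $ a $ b"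
proof -
  define n R where "n = real CARD('n)" and "R = scalar_curvature g x"
  have ric: "ricci g a b x = (R / 2 - \<Lambda>) * g x $ a $ b" for a b
    using assms(1) unfolding vacuum_einstein_at_def R_def by (simp add: algebra_simps)
  have "R = (\<Sum>a\<in>UNIV. \<Sum>b\<in>UNIV. matrix_inv (g x) $ a $ b * ((R / 2 - \<Lambda>) * g x $ a $ b))"
    using R_def unfolding scalar_curvature_def ric .
  also have "\<dots> = (R / 2 - \<Lambda>) * (\<Sum>a\<in>UNIV. \<Sum>b\<in>UNIV. matrix_inv (g x) $ a $ b * g x $ a $ b)"
    by (simp add: sum_distrib_left mult.assoc mult.left_commute)
  finally have "R = (R / 2 - \<Lambda>) * n" by (simp add: trace n_def)
  then have "(n - 2) * (R / 2 - \<Lambda>) = 2 * \<Lambda>" by (simp add: algebra_simps)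
  then show ?thesis by (simp add: ric n_def flip: mult.assoc)
qed

lemma sum_coord:
  "(\<Sum>a\<in>UNIV. P a) = P Time + P Radial + (\<Sum>i\<in>UNIV. P (Transverse (i::'d::finite)))"
proof -
  have "(\<Sum>a\<in>range Transverse. P a) = (\<Sum>i\<in>UNIV. P (Transverse (i::'d)))"
    by (subst sum.reindex) (auto simp: inj_def)
  then show ?thesis
    unfolding UNIV_coord by (subst sum.insert, auto)+ (simp add: add.assoc)
qed

lemma all_coord: "(\<forall>a. P a) \<longleftrightarrow> P Time \<and> P Radial \<and> (\<forall>i. P (Transverse i))"
  by (metis coord.exhaust)

section \<open>Warped static metrics\<close>

text \<open>The diagonal of F dt^2 + G dz^2 + S dSigma^2. The Lorentzian sign is absorbed into F,
  and the black hole profiles are substituted only after the curvature has been computed.\<close>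

definition warped_component ::
    "(real \<Rightarrow> real) \<Rightarrow> (real \<Rightarrow> real) \<Rightarrow> (real \<Rightarrow> real) \<Rightarrow> real \<Rightarrow> 'd coord \<Rightarrow> real^('d::finite coord) \<Rightarrow> real"
where
  "warped_component F G S \<kappa> a x =
    (case a of Time \<Rightarrow> F (x $ Radial) | Radial \<Rightarrow> G (x $ Radial)
     | Transverse i \<Rightarrow> S (x $ Radial) / (1 + \<kappa> * (norm (transverse x))\<^sup>2 / 4)\<^sup>2)"

abbreviation conf :: "real \<Rightarrow> real^('d::finite coord) \<Rightarrow> real" where
  "conf \<kappa> x \<equiv> 1 + \<kappa> * (norm (transverse x))\<^sup>2 / 4"

lemma axis_1_nth: "axis a 1 $ b = (if b = a then 1 else 0)"
  by (simp add: axis_def)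

lemma transverse_add_axis [simp]:
  "transverse (x + s *\<^sub>R axis Time 1) = transverse x"
  "transverse (x + s *\<^sub>R axis Radial 1) = transverse x"
  "transverse (x + s *\<^sub>R axis (Transverse i) 1) = transverse x + s *\<^sub>R axis i 1"
  by (simp_all add: transverse_def Finite_Cartesian_Product.vec_eq_iff axis_1_nth)

lemma norm_add_axis_sq:
  fixes X :: "real^'d::finite"
  shows "(norm (X + s *\<^sub>R axis i 1))\<^sup>2 = (norm X)\<^sup>2 + 2 * s * X $ i + s\<^sup>2"
  unfolding power2_norm_eq_inner
  by (simp add: inner_axis inner_add_left inner_add_right inner_axis' axis_1_nth
      power2_eq_square algebra_simps)

lemma DERIV_shift0:
  assumes "(f has_real_derivative D) (at z)"
  shows "((\<lambda>s. f (z + s)) has_real_derivative D) (at 0)"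
  using assms DERIV_shift[of f D 0 z] by (simp add: add.commute)

lemma pderivative_warped_component:
  fixes x :: "real^('d::finite coord)"
  assumes F: "(F has_real_derivative F') (at (x $ Radial))"
    and G: "(G has_real_derivative G') (at (x $ Radial))"
    and S: "(S has_real_derivative S') (at (x $ Radial))"
    and pos: "conf \<kappa> x > 0"
  shows "pderivative b (warped_component F G S \<kappa> a) x =
    (case b of Time \<Rightarrow> 0
     | Radial \<Rightarrow> (case a of Time \<Rightarrow> F' | Radial \<Rightarrow> G' | Transverse i \<Rightarrow> S' / (conf \<kappa> x)\<^sup>2)
     | Transverse j \<Rightarrow> (case a of Transverse i \<Rightarrow> - S (x $ Radial) * \<kappa> * x $ Transverse j / (conf \<kappa> x)^3
         | _ \<Rightarrow> 0))"
proof -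
  note sh = DERIV_shift0[OF F] DERIV_shift0[OF G] DERIV_shift0[OF S]
  have tr: "x $ Transverse j = transverse x $ j" for j by (simp add: transverse_def)
  show ?thesis
  proof (cases b)
    case Time
    then show ?thesis
      by (cases a) (auto intro!: pderivative_eqI simp: warped_component_def axis_1_nth)
  next
    case Radial
    have "((\<lambda>s. S (x $ Radial + s) / (conf \<kappa> x)\<^sup>2) has_real_derivative S' / (conf \<kappa> x)\<^sup>2) (at 0)"
      by (rule DERIV_cdivide[OF sh(3)])
    then show ?thesis using Radial sh
      by (cases a) (auto intro!: pderivative_eqI simp: warped_component_def axis_1_nth)
  next
    case (Transverse j)
    \<comment> \<open>With \<open>q\<close> the value at s = 0, the conformal denominator along the
      coordinate line is the square of a quadratic polynomial in s.\<close>
    define q where "q = conf \<kappa> x"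
    have "((\<lambda>s. S (x $ Radial) / (q + \<kappa> * (2 * s * transverse x $ j + s\<^sup>2) / 4)\<^sup>2)
       has_real_derivative - S (x $ Radial) * \<kappa> * transverse x $ j / q ^ 3) (at 0)"
      by (rule derivative_eq_intros refl | (use pos in \<open>simp add: q_def; fail\<close>))+
        (use pos in \<open>simp add: field_simps power2_eq_square power3_eq_cube flip: q_def\<close>)
    moreover have "q + \<kappa> * (2 * s * transverse x $ j + s\<^sup>2) / 4 =
        1 + \<kappa> * ((norm (transverse x))\<^sup>2 + 2 * s * transverse x $ j + s\<^sup>2) / 4" for s
      by (simp add: q_def field_simps)
    ultimately have "((\<lambda>s. S (x $ Radial) / (1 + \<kappa> * ((norm (transverse x))\<^sup>2 + 2 * s * transverse x $ j + s\<^sup>2) / 4)\<^sup>2)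
       has_real_derivative - S (x $ Radial) * \<kappa> * transverse x $ j / (conf \<kappa> x)^3) (at 0)"
      by (simp flip: q_def)
    then show ?thesis using Transverse
      by (cases a) (auto intro!: pderivative_eqI simp: warped_component_def axis_1_nth norm_add_axis_sq tr)
  qed
qed


text \<open>The suffixes 1 and 2 stand for first and second derivatives. Supplying these as
  functions keeps \<open>deriv\<close> out of the curvature formulas, and two orders are what the
  Ricci tensor involves.\<close>

locale warped =
  fixes F G S F1 G1 S1 F2 G2 S2 :: "real \<Rightarrow> real" and \<kappa> :: real and U :: "real set"
  assumes open_U: "open U"
    and nonzero: "z \<in> U \<Longrightarrow> F z \<noteq> 0" "z \<in> U \<Longrightarrow> G z \<noteq> 0" "z \<in> U \<Longrightarrow> S z \<noteq> 0"
    and DERIV: "z \<in> U \<Longrightarrow> (F has_real_derivative F1 z) (at z)"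
      "z \<in> U \<Longrightarrow> (G has_real_derivative G1 z) (at z)"
      "z \<in> U \<Longrightarrow> (S has_real_derivative S1 z) (at z)"
    and DERIV2: "z \<in> U \<Longrightarrow> (F1 has_real_derivative F2 z) (at z)"
      "z \<in> U \<Longrightarrow> (G1 has_real_derivative G2 z) (at z)"
      "z \<in> U \<Longrightarrow> (S1 has_real_derivative S2 z) (at z)"
begin

text \<open>The Christoffel symbols of the metric; \<open>v\<close> is the gradient of the logarithm of the conformal
  factor \<open>1 / (conf \<kappa> x)\<^sup>2\<close>.\<close>

definition \<Gamma> :: "'d coord \<Rightarrow> 'd coord \<Rightarrow> 'd coord \<Rightarrow> real^('d::finite coord) \<Rightarrow> real" where
  "\<Gamma> a b c x = (let z = x $ Radial; v = (\<lambda>i. - \<kappa> * transverse x $ i / conf \<kappa> x) in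
     case a of
       Time \<Rightarrow> (case b of Time \<Rightarrow> (case c of Radial \<Rightarrow> F1 z / (2 * F z) | _ \<Rightarrow> 0)
                      | Radial \<Rightarrow> (case c of Time \<Rightarrow> F1 z / (2 * F z) | _ \<Rightarrow> 0)
                      | _ \<Rightarrow> 0)
     | Radial \<Rightarrow> (case b of Time \<Rightarrow> (case c of Time \<Rightarrow> - F1 z / (2 * G z) | _ \<Rightarrow> 0)
                      | Radial \<Rightarrow> (case c of Radial \<Rightarrow> G1 z / (2 * G z) | _ \<Rightarrow> 0)
                      | Transverse i \<Rightarrow> (case c of
                          Transverse j \<Rightarrow> if i = j then - S1 z / (2 * G z * (conf \<kappa> x)\<^sup>2) else 0
                        | _ \<Rightarrow> 0))
     | Transverse i \<Rightarrow> (case b of Time \<Rightarrow> 0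
                      | Radial \<Rightarrow> (case c of
                          Transverse j \<Rightarrow> if i = j then S1 z / (2 * S z) else 0 | _ \<Rightarrow> 0)
                      | Transverse j \<Rightarrow> (case c of Time \<Rightarrow> 0
                        | Radial \<Rightarrow> if i = j then S1 z / (2 * S z) else 0
                        | Transverse k \<Rightarrow> ((if i = k then v j else 0) + (if i = j then v k else 0)
                             - (if j = k then v i else 0)) / 2)))"

abbreviation metric :: "real^('d::finite coord) \<Rightarrow> real^('d coord)^('d coord)" where
  "metric \<equiv> diag_metric (warped_component F G S \<kappa>)"

text \<open>What matters is that this set is open: a closed form of the Christoffel symbols may be
  differentiated only if it holds in a whole neighbourhood of the point.\<close>

definition region :: "(real^('d::finite coord)) set" where
  "region = {x. x $ Radial \<in> U \<and> conf \<kappa> x > 0}"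

lemma open_region: "open (region :: (real^('d::finite coord)) set)"
proof -
  have "open ({x :: real^('d coord). x $ Radial \<in> U} \<inter> {x. conf \<kappa> x > 0})"
  proof (rule open_Int)
    show "open {x :: real^('d coord). x $ Radial \<in> U}"
      using open_U by (intro open_vimage[of U "\<lambda>x. x $ Radial", unfolded vimage_def] continuous_intros)
    show "open {x :: real^('d coord). conf \<kappa> x > 0}"
      unfolding transverse_def by (intro open_Collect_less continuous_intros) auto
  qed
  then show ?thesis by (simp add: region_def Collect_conj_eq)
qed

lemma warped_component_nonzero:
  assumes "x \<in> region"
  shows "warped_component F G S \<kappa> a x \<noteq> 0"
  using assms nonzero by (auto simp: warped_component_def region_def split: coord.split)

lemma christoffel_warped:
  fixes x :: "real^('d::finite coord)"
  assumes x: "x \<in> region"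
  shows "christoffel metric a b c x = \<Gamma> a b c x"
proof -
  have z: "x $ Radial \<in> U" and pos: "conf \<kappa> x > 0" using x by (auto simp: region_def)
  define q where "q = conf \<kappa> x"
  note nz = nonzero[OF z]
  have "q > 0" using pos by (simp add: q_def)
  have tr: "x $ Transverse j = transverse x $ j" for j by (simp add: transverse_def)
  show ?thesis
    unfolding christoffel_diag_metric[of "warped_component F G S \<kappa>", OF warped_component_nonzero[OF x]]
      pderivative_warped_component[OF DERIV(1)[OF z] DERIV(2)[OF z] DERIV(3)[OF z] pos] \<Gamma>_def Let_def
      warped_component_def q_def[symmetric] tr
    using nz \<open>q > 0\<close>
    by (cases a; cases b; cases c)
      (auto simp: divide_simps power2_eq_square power3_eq_cube)
qed

lemma pderivative_christoffel_warped:
  fixes x :: "real^('d::finite coord)"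
  assumes x: "x \<in> region"
  shows "pderivative i (christoffel metric a b c) x = pderivative i (\<Gamma> a b c) x"
  by (rule pderivative_cong)
    (use eventually_nhds_in_open[OF open_region x] in eventually_elim, rule christoffel_warped)


lemma pderivative_\<Gamma>_Time: "pderivative Time (\<Gamma> a b c) x = 0"
  by (rule pderivative_eqI) (cases a; cases b; cases c; cases "b = c"; simp add: \<Gamma>_def Let_def axis_1_nth)

lemma pderivative_\<Gamma>_Radial:
  fixes x :: "real^('d::finite coord)"
  assumes z: "x $ Radial = z" "z \<in> U" and 0: "transverse x = 0"
  shows "pderivative Radial (\<Gamma> Time Time Radial) x = F2 z / (2 * F z) - (F1 z)\<^sup>2 / (2 * (F z)\<^sup>2)"
    "pderivative Radial (\<Gamma> Radial Time Time) x = F1 z * G1 z / (2 * (G z)\<^sup>2) - F2 z / (2 * G z)"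
    "pderivative Radial (\<Gamma> Radial Radial Radial) x = G2 z / (2 * G z) - (G1 z)\<^sup>2 / (2 * (G z)\<^sup>2)"
    "pderivative Radial (\<Gamma> Radial (Transverse i) (Transverse i)) x
       = S1 z * G1 z / (2 * (G z)\<^sup>2) - S2 z / (2 * G z)"
    "pderivative Radial (\<Gamma> (Transverse i) (Transverse i) Radial) x
       = S2 z / (2 * S z) - (S1 z)\<^sup>2 / (2 * (S z)\<^sup>2)"
proof -
  \<comment> \<open>At X = 0 each of the five symbols is a quotient P / (2 Q) up to sign, so a
    single quotient rule serves them all.\<close>
  have q: "((\<lambda>s. P (z + s) / (2 * Q (z + s))) has_real_derivative P1 / (2 * Q z) - P z * Q1 / (2 * (Q z)\<^sup>2)) (at 0)"
    if "(P has_real_derivative P1) (at z)" "(Q has_real_derivative Q1) (at z)" "Q z \<noteq> 0" for P Q P1 Q1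
    by (rule derivative_eq_intros DERIV_shift0 that refl | (use that(3) in \<open>simp; fail\<close>))+
      (use that(3) in \<open>simp add: field_simps power2_eq_square\<close>)
  note d = DERIV[OF z(2)] and d2 = DERIV2[OF z(2)] and nz = nonzero[OF z(2)]
  note qm = DERIV_minus[OF q]
  show "pderivative Radial (\<Gamma> Time Time Radial) x = F2 z / (2 * F z) - (F1 z)\<^sup>2 / (2 * (F z)\<^sup>2)"
    using q[OF d2(1) d(1) nz(1)]
    by (intro pderivative_eqI) (simp add: \<Gamma>_def Let_def z axis_1_nth power2_eq_square)
  show "pderivative Radial (\<Gamma> Radial Time Time) x = F1 z * G1 z / (2 * (G z)\<^sup>2) - F2 z / (2 * G z)"
    using qm[OF d2(1) d(2) nz(2)]
    by (intro pderivative_eqI) (simp add: \<Gamma>_def Let_def z axis_1_nth)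
  show "pderivative Radial (\<Gamma> Radial Radial Radial) x = G2 z / (2 * G z) - (G1 z)\<^sup>2 / (2 * (G z)\<^sup>2)"
    using q[OF d2(2) d(2) nz(2)]
    by (intro pderivative_eqI) (simp add: \<Gamma>_def Let_def z axis_1_nth power2_eq_square)
  show "pderivative Radial (\<Gamma> Radial (Transverse i) (Transverse i)) x
       = S1 z * G1 z / (2 * (G z)\<^sup>2) - S2 z / (2 * G z)"
    using qm[OF d2(3) d(2) nz(2)]
    by (intro pderivative_eqI) (simp add: \<Gamma>_def Let_def z 0 axis_1_nth)
  show "pderivative Radial (\<Gamma> (Transverse i) (Transverse i) Radial) x
       = S2 z / (2 * S z) - (S1 z)\<^sup>2 / (2 * (S z)\<^sup>2)"
    using q[OF d2(3) d(3) nz(3)]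
    by (intro pderivative_eqI) (simp add: \<Gamma>_def Let_def z axis_1_nth power2_eq_square)
qed

text \<open>The purely transverse symbols vanish at X = 0 since \<open>v\<close> does, but the
  derivative of \<open>v i\<close> in direction l is there - \<kappa> if i = l and 0 otherwise. The
  curvature of Sigma enters the Ricci tensor through this first-order term.\<close>

lemma pderivative_\<Gamma>_Transverse:
  fixes x :: "real^('d::finite coord)"
  assumes 0: "transverse x = 0"
  shows "pderivative (Transverse l) (\<Gamma> (Transverse i) (Transverse j) (Transverse k)) x
    = - \<kappa> / 2 * ((if i = k \<and> j = l then 1 else 0) + (if i = j \<and> k = l then 1 else 0)
       - (if j = k \<and> i = l then 1 else 0))"
proof -
  have "((\<lambda>s. s / (1 + \<kappa> * s\<^sup>2 / 4)) has_real_derivative 1) (at 0)"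
    by (rule derivative_eq_intros refl | (simp; fail))+
  then have d: "((\<lambda>s. C * (s / (1 + \<kappa> * s\<^sup>2 / 4))) has_real_derivative C) (at 0)" for C :: real
    using DERIV_cmult[of "\<lambda>s. s / (1 + \<kappa> * s\<^sup>2 / 4)" 1 0 UNIV C] by simp
  have e: "\<kappa> * s * 2 / (2 + \<kappa> * s\<^sup>2 / 2) = \<kappa> * s / (1 + \<kappa> * s\<^sup>2 / 4)" for s
    using mult_divide_mult_cancel_left[of 2 "\<kappa> * s" "1 + \<kappa> * s\<^sup>2 / 4"] by (simp add: mult.commute)
  show ?thesis
    by (rule pderivative_eqI, rule has_field_derivative_transform_within[OF d, of 1])
      (auto simp: \<Gamma>_def Let_def 0 axis_1_nth e mult.commute[of _ \<kappa>])
qed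

lemma pderivative_\<Gamma>_Transverse_0:
  "pderivative (Transverse l) (\<Gamma> (Transverse i) Time Time) x = 0"
  "pderivative (Transverse l) (\<Gamma> (Transverse i) Radial Radial) x = 0"
  "pderivative (Transverse l) (\<Gamma> Time Time (Transverse i)) x = 0"
  "pderivative (Transverse l) (\<Gamma> Radial Radial (Transverse i)) x = 0"
  by (rule pderivative_eqI, simp add: \<Gamma>_def Let_def axis_1_nth)+

lemma in_region_0:
  assumes "x $ Radial \<in> U" "transverse x = 0"
  shows "x \<in> region"
  using assms by (simp add: region_def)

section \<open>Ricci components at the origin of the transverse chart\<close>

context
  fixes x :: "real^('d::finite coord)" and z
  assumes z: "x $ Radial = z" "z \<in> U" and 0: "transverse x = 0"
begin

lemma ricci_metric:
  "ricci metric b c x = (\<Sum>a\<in>UNIV. pderivative a (\<Gamma> a c b) x - pderivative c (\<Gamma> a a b) x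
     + (\<Sum>e\<in>UNIV. \<Gamma> a a e x * \<Gamma> e c b x - \<Gamma> a c e x * \<Gamma> e a b x))"
  using in_region_0[of x] z 0
  by (simp add: ricci_def riemann_def pderivative_christoffel_warped christoffel_warped)

lemma summand: "\<kappa> * (2 * (if j = i \<and> i = j then 1 else 0) - 1) / 2 = (if i = j then \<kappa> else 0) - \<kappa> / 2"
  by (simp add: field_simps)

lemmas \<Gamma>_simps = pderivative_\<Gamma>_Time pderivative_\<Gamma>_Radial[OF z 0] pderivative_\<Gamma>_Transverse[OF 0]
  pderivative_\<Gamma>_Transverse_0

lemma ricci_Time:
  "ricci metric Time Time x = - F2 z / (2 * G z) + F1 z / (4 * G z) * (F1 z / F z + G1 z / G z)
     - real CARD('d) * F1 z * S1 z / (4 * G z * S z)"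
  unfolding ricci_metric sum_coord \<Gamma>_simps
  using nonzero[OF z(2)]
  by (simp add: \<Gamma>_def Let_def z 0 sum.distrib sum_subtractf sum_negf summand
      if_distrib[where f = "\<lambda>y. y * _"] cong: if_cong)
    (simp add: field_simps power2_eq_square)

lemma ricci_Radial:
  "ricci metric Radial Radial x =
     - F2 z / (2 * F z) + (F1 z)\<^sup>2 / (4 * (F z)\<^sup>2) + F1 z * G1 z / (4 * F z * G z)
     - real CARD('d) * (S2 z / (2 * S z) - (S1 z)\<^sup>2 / (4 * (S z)\<^sup>2) - S1 z * G1 z / (4 * S z * G z))"
  unfolding ricci_metric sum_coord \<Gamma>_simps
  using nonzero[OF z(2)]
  by (simp add: \<Gamma>_def Let_def z 0 sum.distrib sum_subtractf sum_negf summand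
      if_distrib[where f = "\<lambda>y. y * _"] cong: if_cong)
    (simp add: field_simps power2_eq_square)

text \<open>At X = 0 the conformal factor is 1 and the purely transverse symbols vanish, so Sigma
  itself contributes its Einstein constant (d - 1) \<kappa>; everything else is extrinsic, from the
  dependence of S on z.\<close>

lemma ricci_Transverse:
  "ricci metric (Transverse i) (Transverse i) x =
     (real CARD('d) - 1) * \<kappa> - (S2 z / (2 * G z) - S1 z * G1 z / (4 * (G z)\<^sup>2)
       + S1 z * F1 z / (4 * F z * G z) + (real CARD('d) - 2) * (S1 z)\<^sup>2 / (4 * S z * G z))"
  unfolding ricci_metric sum_coord \<Gamma>_simps
  using nonzero[OF z(2)]
  by (simp add: \<Gamma>_def Let_def z 0 sum.distrib sum_subtractf sum_negf summand
      if_distrib[where f = "\<lambda>y. y * _"] cong: if_cong)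
    (simp add: field_simps power2_eq_square)

end

end

context warped begin

text \<open>In \<open>R\<^sub>t\<^sub>t / F - R\<^sub>r\<^sub>r / G\<close> the second derivative of \<open>F\<close> cancels.\<close>

lemma ricci_Time_Radial:
  fixes x :: "real^('d::finite coord)"
  assumes z: "x $ Radial = z" "z \<in> U" and 0: "transverse x = 0"
    and "ricci metric Time Time x = k * F z" "ricci metric Radial Radial x = k * G z"
  shows "S2 z / (2 * S z) - (S1 z)\<^sup>2 / (4 * (S z)\<^sup>2) = S1 z / (4 * S z) * (F1 z / F z + G1 z / G z)"
proof -
  note nz = nonzero[OF z(2)]
  define D where "D = S2 z / (2 * S z) - (S1 z)\<^sup>2 / (4 * (S z)\<^sup>2) - S1 z / (4 * S z) * (F1 z / F z + G1 z / G z)"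
  have "real CARD('d) / G z * D = ricci metric Time Time x / F z - ricci metric Radial Radial x / G z"
    unfolding ricci_Time[OF z 0] ricci_Radial[OF z 0] D_def using nz
    by (simp add: field_simps power2_eq_square)
  also have "\<dots> = 0" using assms nz by simp
  finally show ?thesis using nz by (simp add: D_def)
qed

end

section \<open>Field equations of the black hole\<close>

lemma bh_metric_eq_diag_metric:
  "bh_metric \<kappa> f1 f2 =
    diag_metric (warped_component (\<lambda>z. - f1 z / z\<^sup>2) (\<lambda>z. 1 / (z\<^sup>2 * f2 z)) (\<lambda>z. 1 / z\<^sup>2) \<kappa>)"
  by (intro ext)
    (simp add: Finite_Cartesian_Product.vec_eq_iff all_coord bh_metric_def Let_def diag_metric_nth warped_component_def
      sigma_metric_def)

lemma warped_bh:
  fixes f1 f2 :: "real \<Rightarrow> real"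
  assumes "open U"
    and nonzero: "\<And>z. z \<in> U \<Longrightarrow> z \<noteq> 0" "\<And>z. z \<in> U \<Longrightarrow> f1 z \<noteq> 0" "\<And>z. z \<in> U \<Longrightarrow> f2 z \<noteq> 0"
    and D1: "\<And>z. z \<in> U \<Longrightarrow> (f1 has_real_derivative f1' z) (at z)"
      "\<And>z. z \<in> U \<Longrightarrow> (f1' has_real_derivative f1'' z) (at z)"
    and D2: "\<And>z. z \<in> U \<Longrightarrow> (f2 has_real_derivative f2' z) (at z)"
      "\<And>z. z \<in> U \<Longrightarrow> (f2' has_real_derivative f2'' z) (at z)"
  shows "warped (\<lambda>z. - f1 z / z\<^sup>2) (\<lambda>z. 1 / (z\<^sup>2 * f2 z)) (\<lambda>z. 1 / z\<^sup>2)
    (\<lambda>z. 2 * f1 z / z ^ 3 - f1' z / z\<^sup>2)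
    (\<lambda>z. - 2 / (z ^ 3 * f2 z) - f2' z / (z\<^sup>2 * (f2 z)\<^sup>2))
    (\<lambda>z. - 2 / z ^ 3)
    (\<lambda>z. 4 * f1' z / z ^ 3 - 6 * f1 z / z ^ 4 - f1'' z / z\<^sup>2)
    (\<lambda>z. 6 / (z ^ 4 * f2 z) + 4 * f2' z / (z ^ 3 * (f2 z)\<^sup>2) - f2'' z / (z\<^sup>2 * (f2 z)\<^sup>2)
      + 2 * (f2' z)\<^sup>2 / (z\<^sup>2 * (f2 z) ^ 3))
    (\<lambda>z. 6 / z ^ 4) U"
proof unfold_locales
  fix z assume z: "z \<in> U"
  note nz = nonzero[OF z]
  note D = D1[OF z] D2[OF z]
  \<comment> \<open>The second derivative of G is treated separately: written with
    \<open>inverse\<close>, it is a polynomial in \<open>inverse z\<close>,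
    \<open>inverse (f2 z)\<close> and the derivatives of \<open>f2\<close>, so that its verification
    is ring arithmetic.\<close>
  have "((\<lambda>z. - 2 * (inverse z) ^ 3 * inverse (f2 z) - f2' z * (inverse z)\<^sup>2 * (inverse (f2 z))\<^sup>2)
    has_real_derivative
      6 * inverse z ^ 4 * inverse (f2 z) + 4 * f2' z * inverse z ^ 3 * (inverse (f2 z))\<^sup>2
      - f2'' z * (inverse z)\<^sup>2 * (inverse (f2 z))\<^sup>2 + 2 * (f2' z)\<^sup>2 * (inverse z)\<^sup>2 * (inverse (f2 z)) ^ 3) (at z)"
    by (rule derivative_eq_intros D nz refl)+
      (simp add: algebra_simps power2_eq_square power3_eq_cube power4_eq_xxxx)
  then show "((\<lambda>z. - 2 / (z ^ 3 * f2 z) - f2' z / (z\<^sup>2 * (f2 z)\<^sup>2)) has_real_derivative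
      6 / (z ^ 4 * f2 z) + 4 * f2' z / (z ^ 3 * (f2 z)\<^sup>2) - f2'' z / (z\<^sup>2 * (f2 z)\<^sup>2)
      + 2 * (f2' z)\<^sup>2 / (z\<^sup>2 * (f2 z) ^ 3)) (at z)"
    by (simp add: divide_inverse power_inverse mult.assoc)
qed (use assms in \<open>auto intro!: derivative_eq_intros
      simp: field_simps power2_eq_square power3_eq_cube power4_eq_xxxx\<close>)

text \<open>For S = 1/z^2 the identity \<open>ricci_Time_Radial\<close> says F'/F + G'/G = -4/z,
  that is, f1'/f1 = f2'/f2. Both conclusions are stated without denominators so that they remain
  meaningful where f1 and f2 vanish.\<close>

lemma vacuum_einstein_bh_ode:
  fixes x :: "real^('d::finite coord)" and f1 f2 :: "real \<Rightarrow> real"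
  assumes U: "open U" "z \<in> U"
    and nonzero: "\<And>z. z \<in> U \<Longrightarrow> z \<noteq> 0" "\<And>z. z \<in> U \<Longrightarrow> f1 z \<noteq> 0" "\<And>z. z \<in> U \<Longrightarrow> f2 z \<noteq> 0"
    and D1: "\<And>z. z \<in> U \<Longrightarrow> (f1 has_real_derivative f1' z) (at z)"
      "\<And>z. z \<in> U \<Longrightarrow> (f1' has_real_derivative f1'' z) (at z)"
    and D2: "\<And>z. z \<in> U \<Longrightarrow> (f2 has_real_derivative f2' z) (at z)"
      "\<And>z. z \<in> U \<Longrightarrow> (f2' has_real_derivative f2'' z) (at z)"
    and x: "x $ Radial = z" "transverse x = 0"
    and einstein: "vacuum_einstein_at (bh_metric \<kappa> f1 f2) (- (real CARD('d) * (real CARD('d) + 1) / 2)) x"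
  shows "f1' z * f2 z = f1 z * f2' z"
    and "z * f2' z = (real CARD('d) + 1) * f2 z - (real CARD('d) + 1) - (real CARD('d) - 1) * \<kappa> * z\<^sup>2"
proof -
  interpret warped "\<lambda>z. - f1 z / z\<^sup>2" "\<lambda>z. 1 / (z\<^sup>2 * f2 z)" "\<lambda>z. 1 / z\<^sup>2"
    "\<lambda>z. 2 * f1 z / z ^ 3 - f1' z / z\<^sup>2"
    "\<lambda>z. - 2 / (z ^ 3 * f2 z) - f2' z / (z\<^sup>2 * (f2 z)\<^sup>2)"
    "\<lambda>z. - 2 / z ^ 3"
    "\<lambda>z. 4 * f1' z / z ^ 3 - 6 * f1 z / z ^ 4 - f1'' z / z\<^sup>2"
    "\<lambda>z. 6 / (z ^ 4 * f2 z) + 4 * f2' z / (z ^ 3 * (f2 z)\<^sup>2) - f2'' z / (z\<^sup>2 * (f2 z)\<^sup>2)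
      + 2 * (f2' z)\<^sup>2 / (z\<^sup>2 * (f2 z) ^ 3)"
    "\<lambda>z. 6 / z ^ 4" \<kappa> U
    by (rule warped_bh) (use assms in auto)
  let ?n = "real CARD('d)"
  note nz = nonzero[OF \<open>z \<in> U\<close>]
  have reg: "x \<in> region" using in_region_0[of x] x \<open>z \<in> U\<close> by simp
  note wnz = warped_component_nonzero[OF reg]
  have "(real CARD('d coord) - 2) * ricci metric a b x
      = 2 * (- (?n * (?n + 1) / 2)) * metric x $ a $ b" for a b
  proof (rule vacuum_einstein_at_imp_ricci)
    show "vacuum_einstein_at metric (- (?n * (?n + 1) / 2)) x"
      using einstein by (simp add: bh_metric_eq_diag_metric)
    show "(\<Sum>a\<in>UNIV. \<Sum>b\<in>UNIV. matrix_inv (metric x) $ a $ b * metric x $ a $ b) = real CARD('d coord)"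
      unfolding matrix_inv_diag_metric[of "warped_component _ _ _ _", OF wnz] diag_metric_nth
      using wnz by (simp add: if_distrib[where f = "\<lambda>y. y * _"] cong: if_cong)
  qed
  then have "?n * ricci metric a a x = ?n * (- (?n + 1) * metric x $ a $ a)" for a
    by (simp add: card_coord algebra_simps)
  then have ric: "ricci metric a a x = - (?n + 1) * metric x $ a $ a" for a
    by (simp only: mult_cancel_left) simp
  have "ricci metric Time Time x = - (?n + 1) * (- f1 z / z\<^sup>2)"
      "ricci metric Radial Radial x = - (?n + 1) * (1 / (z\<^sup>2 * f2 z))"
    unfolding ric by (simp_all add: diag_metric_nth warped_component_def x)
  from ricci_Time_Radial[OF x(1) U(2) x(2) this]
  show 1: "f1' z * f2 z = f1 z * f2' z"
    using nz by (simp add: field_simps power2_eq_square power3_eq_cube power4_eq_xxxx)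
  \<comment> \<open>Types are nonempty, so a transverse direction exists, and one diagonal component
    suffices for the second equation.\<close>
  fix i :: 'd
  have "ricci metric (Transverse i) (Transverse i) x = - (?n + 1) * (1 / z\<^sup>2)"
    unfolding ric by (simp add: diag_metric_nth warped_component_def x)
  moreover have "6 / z ^ 4 / (2 * (1 / (z\<^sup>2 * f2 z)))
      - - 2 / z ^ 3 * (- 2 / (z ^ 3 * f2 z) - f2' z / (z\<^sup>2 * (f2 z)\<^sup>2)) / (4 * (1 / (z\<^sup>2 * f2 z))\<^sup>2)
      + - 2 / z ^ 3 * (2 * f1 z / z ^ 3 - f1' z / z\<^sup>2) / (4 * (- f1 z / z\<^sup>2) * (1 / (z\<^sup>2 * f2 z)))
      + (?n - 2) * (- 2 / z ^ 3)\<^sup>2 / (4 * (1 / z\<^sup>2) * (1 / (z\<^sup>2 * f2 z)))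
    = (?n + 1) * f2 z / z\<^sup>2 - (f2' z + f2 z * f1' z / f1 z) / (2 * z)"
    using nz by (simp add: field_simps power2_eq_square power3_eq_cube power4_eq_xxxx)
  ultimately have "(?n - 1) * \<kappa> - ((?n + 1) * f2 z / z\<^sup>2 - (f2' z + f2 z * f1' z / f1 z) / (2 * z))
      = - (?n + 1) * (1 / z\<^sup>2)"
    unfolding ricci_Transverse[OF x(1) U(2) x(2)] by simp
  \<comment> \<open>The first equation removes \<open>f1\<close> from the transverse one, which
    becomes a linear first-order equation for \<open>f2\<close> alone.\<close>
  moreover have "f2 z * f1' z / f1 z = f2' z" using 1 nz by (simp add: field_simps)
  ultimately have "z\<^sup>2 * ((?n - 1) * \<kappa> - ((?n + 1) * f2 z / z\<^sup>2 - f2' z / z)) = - (?n + 1)"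
    using nz by simp
  moreover have "z\<^sup>2 * ((?n - 1) * \<kappa> - ((?n + 1) * f2 z / z\<^sup>2 - f2' z / z))
      = (?n - 1) * \<kappa> * z\<^sup>2 - (?n + 1) * f2 z + z * f2' z"
    using nz by (simp add: field_simps power2_eq_square)
  ultimately show "z * f2' z = (?n + 1) * f2 z - (?n + 1) - (?n - 1) * \<kappa> * z\<^sup>2"
    by linarith
qed

section \<open>Towers of derivatives\<close>

text \<open>All derivatives are carried along as one explicit sequence. Differences, scalar
  multiples, shifts and Leibniz products of towers are again towers, so a differential equation can
  be differentiated k times by reading off level k.\<close>

definition deriv_tower :: "real set \<Rightarrow> (nat \<Rightarrow> real \<Rightarrow> real) \<Rightarrow> bool" where
  "deriv_tower U D \<longleftrightarrow> open U \<and> (\<forall>k. \<forall>z\<in>U. (D k has_real_derivative D (Suc k) z) (at z))"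

lemma deriv_towerD: "deriv_tower U D \<Longrightarrow> z \<in> U \<Longrightarrow> (D k has_real_derivative D (Suc k) z) (at z)"
  and deriv_tower_open: "deriv_tower U D \<Longrightarrow> open U"
  by (auto simp: deriv_tower_def)

lemma deriv_tower_subset: "deriv_tower U D \<Longrightarrow> V \<subseteq> U \<Longrightarrow> open V \<Longrightarrow> deriv_tower V D"
  by (auto simp: deriv_tower_def)

lemma deriv_tower_shift: "deriv_tower U D \<Longrightarrow> deriv_tower U (\<lambda>k. D (Suc k))"
  by (auto simp: deriv_tower_def)

lemma deriv_tower_diff:
  "deriv_tower U D \<Longrightarrow> deriv_tower U E \<Longrightarrow> deriv_tower U (\<lambda>k z. D k z - E k z)"
  by (auto simp: deriv_tower_def intro!: DERIV_diff)

lemma deriv_tower_cmult: "deriv_tower U D \<Longrightarrow> deriv_tower U (\<lambda>k z. c * D k z)"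
  by (auto simp: deriv_tower_def intro!: DERIV_cmult)

lemma deriv_tower_const: "open U \<Longrightarrow> deriv_tower U (\<lambda>k z. if k = 0 then c else 0)"
  by (auto simp: deriv_tower_def)

lemma deriv_tower_ident: "open U \<Longrightarrow> deriv_tower U (\<lambda>k z. if k = 0 then z else if k = 1 then 1 else 0)"
  by (auto simp: deriv_tower_def)

lemma deriv_tower_inverse:
  assumes "open U" "0 \<notin> U"
  shows "deriv_tower U (\<lambda>k z. (- 1) ^ k * fact k * inverse z ^ Suc k)"
  unfolding deriv_tower_def
proof (intro conjI allI ballI)
  fix k z assume "z \<in> U"
  then have "z \<noteq> 0" using assms by auto
  then show "((\<lambda>z. (- 1) ^ k * fact k * inverse z ^ Suc k) has_real_derivative
      (- 1) ^ Suc k * fact (Suc k) * inverse z ^ Suc (Suc k)) (at z)"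
    using DERIV_cmult[OF DERIV_power[OF DERIV_inverse[of z UNIV], of "Suc k"], of "(- 1) ^ k * fact k"]
    by (simp add: algebra_simps)
qed (fact assms)

definition leibniz :: "(nat \<Rightarrow> real \<Rightarrow> real) \<Rightarrow> (nat \<Rightarrow> real \<Rightarrow> real) \<Rightarrow> nat \<Rightarrow> real \<Rightarrow> real" where
  "leibniz D E k z = (\<Sum>i\<le>k. real (k choose i) * D i z * E (k - i) z)"

lemma deriv_tower_leibniz:
  assumes "deriv_tower U D" "deriv_tower U E"
  shows "deriv_tower U (leibniz D E)"
  unfolding deriv_tower_def
proof (intro conjI allI ballI)
  show "open U" using assms(1) by (rule deriv_tower_open)
  fix k z assume z: "z \<in> U"
  let ?c = "\<lambda>k i. real (k choose i)"
  have "((\<lambda>z. \<Sum>i\<le>k. ?c k i * D i z * E (k - i) z) has_real_derivative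
    (\<Sum>i\<le>k. ?c k i * D (Suc i) z * E (k - i) z + ?c k i * D i z * E (Suc (k - i)) z)) (at z)"
    by (rule derivative_eq_intros deriv_towerD[OF assms(1) z] deriv_towerD[OF assms(2) z] refl)+
      (simp add: algebra_simps)
  moreover have "(\<Sum>i\<le>k. ?c k i * D (Suc i) z * E (k - i) z + ?c k i * D i z * E (Suc (k - i)) z)
      = leibniz D E (Suc k) z"
  proof -
    \<comment> \<open>The added term i = k + 1 is zero because its binomial coefficient is.
      Splitting off i = 0 then aligns the two sums for Pascal's rule.\<close>
    have "(\<Sum>i\<le>k. ?c k i * D i z * E (Suc (k - i)) z) = (\<Sum>i\<le>Suc k. ?c k i * D i z * E (Suc k - i) z)"
      by (simp add: Suc_diff_le)
    also have "\<dots> = D 0 z * E (Suc k) z + (\<Sum>i\<le>k. ?c k (Suc i) * D (Suc i) z * E (k - i) z)"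
      by (subst sum.atMost_Suc_shift) simp
    finally show ?thesis
      unfolding leibniz_def sum.atMost_Suc_shift[of _ k]
      by (simp add: sum.distrib algebra_simps)
  qed
  ultimately show "(leibniz D E k has_real_derivative leibniz D E (Suc k) z) (at z)"
    by (simp add: leibniz_def[abs_def])
qed

text \<open>Termwise differentiation: iterating \<open>diffs\<close> gives the coefficients of the
  successive derivatives, and convergence persists on the same interval.\<close>

lemma real_analytic_at_imp_deriv_tower:
  assumes "real_analytic_at f x0"
  obtains D r where "r > 0" "deriv_tower (ball x0 r) D" "D 0 = f"
proof -
  from assms obtain r a where r: "r > 0"
    and sums: "\<And>x. \<bar>x - x0\<bar> < r \<Longrightarrow> (\<lambda>n. a n * (x - x0) ^ n) sums f x"
    unfolding real_analytic_at_def by blast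
  have summ: "summable (\<lambda>n. (diffs ^^ k) a n * y ^ n)" if "norm y < r" for k y
    using that
  proof (induction k arbitrary: y)
    case 0
    then show ?case using sums[of "x0 + y"] by (auto simp: sums_iff)
  next
    case (Suc k)
    show ?case using termdiff_converges[OF Suc.prems Suc.IH] by simp
  qed
  define P where "P = (\<lambda>k z. \<Sum>n. (diffs ^^ k) a n * (z - x0) ^ n)"
  have P: "(P k has_real_derivative P (Suc k) z) (at z)" if "z \<in> ball x0 r" for k z
  proof -
    have "((\<lambda>y. \<Sum>n. (diffs ^^ k) a n * y ^ n) has_real_derivative P (Suc k) z) (at (z - x0))"
      using termdiffs_strong'[of r "(diffs ^^ k) a" "z - x0", OF summ] that
      by (simp add: P_def dist_real_def abs_minus_commute)
    from DERIV_chain2[where g = "\<lambda>z. z - x0" and x = z, OF this, of 1] show ?thesis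
      unfolding P_def by (simp add: DERIV_diff[OF DERIV_ident DERIV_const, simplified])
  qed
  have f: "f z = P 0 z" if "z \<in> ball x0 r" for z
    using sums[of z] that by (simp add: P_def dist_real_def abs_minus_commute sums_iff)
  have "(f has_real_derivative P (Suc 0) z) (at z)" if "z \<in> ball x0 r" for z
    by (rule has_field_derivative_transform_within_open[OF P open_ball that]) (use that f in auto)
  \<comment> \<open>Level 0 is \<open>f\<close> itself, since \<open>P 0\<close> is known to equal
    it on the ball only, whereas \<open>D 0 = f\<close> is an equation of functions.\<close>
  with P have "deriv_tower (ball x0 r) (\<lambda>k. if k = 0 then f else P k)"
    by (simp add: deriv_tower_def)
  with r show ?thesis by (rule that) simp
qed

text \<open>Uniqueness of derivatives makes every level vanish on an open interval ending at 1, and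
  each level is continuous at 1. This carries one-sided identities to the horizon.\<close>

lemma deriv_tower_vanish:
  assumes D: "deriv_tower U D" and "1 \<in> U"
    and ev: "\<forall>\<^sub>F z in at_left 1. D 0 z = 0"
  shows "D k 1 = 0"
proof -
  from D \<open>1 \<in> U\<close> have "\<forall>\<^sub>F z in at_left (1::real). z \<in> U"
    by (metis deriv_tower_open eventually_at_topological)
  with ev have "\<forall>\<^sub>F z in at_left 1. D 0 z = 0 \<and> z \<in> U" by eventually_elim simp
  then obtain b where b: "b < 1" "\<And>z. b < z \<Longrightarrow> z < 1 \<Longrightarrow> D 0 z = 0 \<and> z \<in> U"
    unfolding eventually_at_left_field by blast
  have zero: "D k z = 0" if "z \<in> {b<..<1}" for k z
    using that
  proof (induction k arbitrary: z)
    case (Suc k)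
    have "((\<lambda>_. 0) has_real_derivative D (Suc k) z) (at z)"
      by (rule has_field_derivative_transform_within_open[of "D k" _ _ "{b<..<1}"])
        (use Suc b deriv_towerD[OF D] in auto)
    then show ?case using DERIV_unique[OF _ DERIV_const] by blast
  qed (use b in auto)
  have "isCont (D k) 1" using deriv_towerD[OF D \<open>1 \<in> U\<close>] by (rule DERIV_isCont)
  then have "(D k \<longlongrightarrow> D k 1) (at_left 1)"
    unfolding isCont_def by (rule filterlim_mono) (auto simp: at_within_le_at)
  moreover have "\<forall>\<^sub>F z in at_left 1. D k z = 0"
    unfolding eventually_at_left_field using b(1) zero by auto
  ultimately have "((\<lambda>_. 0) \<longlongrightarrow> D k 1) (at_left (1::real))"
    by (rule Lim_transform_eventually)
  then show ?thesis by (simp add: tendsto_const_iff trivial_limit_at_left_real)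
qed

text \<open>The affine form serves all three coefficients of the scalar equation: c = 0 and b = 1
  for A and B, c = \<omega>^2 and b = - \<mu> for C. The constant c survives at order 0
  only.\<close>

lemma horizon_coeff_deriv_tower:
  assumes D: "deriv_tower U D" and "1 \<in> U" and F: "\<And>z. z \<in> U \<Longrightarrow> F z = c + b * of_real (D 0 z)"
  shows "horizon_coeff F (int k) = (if k = 0 then c else 0) + b * of_real (D k 1 / fact k)"
proof -
  have "((\<lambda>G z. vector_derivative G (at z)) ^^ k) F z = (if k = 0 then c else 0) + b * of_real (D k z)"
    if "z \<in> U" for z
    using that
  proof (induction k arbitrary: z)
    case (Suc k)
    have "((\<lambda>z. of_real (D k z)) has_vector_derivative (of_real (D (Suc k) z) :: complex)) (at z)"
      by (intro has_vector_derivative_of_real)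
        (use deriv_towerD[OF D Suc.prems] in \<open>simp add: has_real_derivative_iff_has_vector_derivative\<close>)
    from has_vector_derivative_add[OF has_vector_derivative_const has_vector_derivative_mult_right[OF this]]
    have "((\<lambda>z. (if k = 0 then c else 0) + b * of_real (D k z)) has_vector_derivative b * of_real (D (Suc k) z)) (at z)"
      by simp
    then have "(((\<lambda>G z. vector_derivative G (at z)) ^^ k) F has_vector_derivative b * of_real (D (Suc k) z)) (at z)"
      by (rule has_vector_derivative_transform_within_open[OF _ deriv_tower_open[OF D] Suc.prems])
        (simp add: Suc.IH)
    then show ?case by (simp add: vector_derivative_at)
  qed (simp add: F)
  from this[OF \<open>1 \<in> U\<close>] show ?thesis by (simp add: horizon_coeff_def)
qed

lemma eventually_at_left_nonzero:
  fixes f :: "real \<Rightarrow> real"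
  assumes "(f has_real_derivative D) (at a)" "f a = 0" "D \<noteq> 0"
  shows "\<forall>\<^sub>F z in at_left a. f z \<noteq> 0"
proof -
  have "((\<lambda>z. (f z - f a) / (z - a)) \<longlongrightarrow> D) (at a)"
    using assms(1) by (simp add: has_field_derivative_iff)
  then have "\<forall>\<^sub>F z in at a. (f z - f a) / (z - a) \<noteq> 0"
    using assms(3) by (rule tendsto_imp_eventually_ne)
  then have "\<forall>\<^sub>F z in at a. f z \<noteq> 0"
    by eventually_elim (use assms(2) in auto)
  then show ?thesis by (rule filter_leD[OF at_le, rotated]) simp
qed

lemma vacuum_einstein_bh_ode_at_left:
  fixes f1 f2 :: "real \<Rightarrow> real"
  assumes D1: "deriv_tower U D1" "D1 0 = f1" and D2: "deriv_tower U D2" "D2 0 = f2"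
    and U: "1 \<in> U" "0 \<notin> U"
    and horizon: "f1 1 = 0" "f2 1 = 0" "D1 1 1 \<noteq> 0" "D2 1 1 \<noteq> 0"
    and einstein: "\<forall>\<^sub>F z in at_left 1. \<forall>x :: real^('d::finite coord).
      x $ Radial = z \<longrightarrow> transverse x \<in> sigma_chart \<kappa> \<longrightarrow>
      vacuum_einstein_at (bh_metric \<kappa> f1 f2) (- (real CARD('d) * (real CARD('d) + 1) / 2)) x"
  shows "\<forall>\<^sub>F z in at_left 1. D1 1 z * D2 0 z = D1 0 z * D2 1 z"
    and "\<forall>\<^sub>F z in at_left 1. z * D2 1 z =
      (real CARD('d) + 1) * D2 0 z - (real CARD('d) + 1) - (real CARD('d) - 1) * \<kappa> * z\<^sup>2"
proof -
  have dd: "(f1 has_real_derivative D1 1 z) (at z)" "(D1 1 has_real_derivative D1 2 z) (at z)"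
      "(f2 has_real_derivative D2 1 z) (at z)" "(D2 1 has_real_derivative D2 2 z) (at z)" if "z \<in> U" for z
    using deriv_towerD[OF D1(1) that, of 0] deriv_towerD[OF D1(1) that, of 1]
      deriv_towerD[OF D2(1) that, of 0] deriv_towerD[OF D2(1) that, of 1]
    by (simp_all add: D1(2) D2(2) numeral_2_eq_2)
  have "\<forall>\<^sub>F z in at_left (1::real). z \<in> U"
    using deriv_tower_open[OF D1(1)] U(1) by (metis eventually_at_topological)
  then have "\<forall>\<^sub>F z in at_left 1. z \<in> U \<and> f1 z \<noteq> 0 \<and> f2 z \<noteq> 0"
    using eventually_at_left_nonzero[OF dd(1)[OF U(1)] horizon(1,3)]
      eventually_at_left_nonzero[OF dd(3)[OF U(1)] horizon(2,4)]
    by eventually_elim simp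
  \<comment> \<open>\<open>vacuum_einstein_bh_ode\<close> requires nonzero profiles on an open set
    around z, hence a fixed interval; it exists because the zeros at the horizon are simple.\<close>
  then obtain b where b: "b < 1" "\<And>z. z \<in> {b<..<1} \<Longrightarrow> z \<in> U \<and> f1 z \<noteq> 0 \<and> f2 z \<noteq> 0"
    unfolding eventually_at_left_field by auto
  have "\<forall>\<^sub>F z in at_left 1. z \<in> {b<..<1}"
    using b(1) unfolding eventually_at_left_field by auto
  with einstein have "\<forall>\<^sub>F z in at_left 1. D1 1 z * D2 0 z = D1 0 z * D2 1 z \<and>
      z * D2 1 z = (real CARD('d) + 1) * D2 0 z - (real CARD('d) + 1) - (real CARD('d) - 1) * \<kappa> * z\<^sup>2"
  proof eventually_elim
    case (elim z)
    \<comment> \<open>The transverse origin lies in \<open>sigma_chart \<kappa>\<close> for every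
      \<kappa>, so the hypothesis applies to this point.\<close>
    define x :: "real^('d coord)" where "x = (\<chi> a. if a = Radial then z else 0)"
    have x: "x $ Radial = z" "transverse x = 0"
      by (simp_all add: x_def transverse_def Finite_Cartesian_Product.vec_eq_iff)
    then have "vacuum_einstein_at (bh_metric \<kappa> f1 f2) (- (real CARD('d) * (real CARD('d) + 1) / 2)) x"
      using elim(1) by (simp add: sigma_chart_def)
    have V: "w \<noteq> 0" "f1 w \<noteq> 0" "f2 w \<noteq> 0" "w \<in> U" if "w \<in> {b<..<1}" for w
      using b(2)[OF that] U(2) by auto
    note ode = vacuum_einstein_bh_ode[where U = "{b<..<1}" and \<kappa> = \<kappa>, OF open_greaterThanLessThan elim(2)
        V(1,2,3) dd[OF V(4)] x \<open>vacuum_einstein_at _ _ x\<close>]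
    show ?case unfolding D1(2) D2(2) by (intro conjI ode)
  qed
  then show "\<forall>\<^sub>F z in at_left 1. D1 1 z * D2 0 z = D1 0 z * D2 1 z"
    and "\<forall>\<^sub>F z in at_left 1. z * D2 1 z =
      (real CARD('d) + 1) * D2 0 z - (real CARD('d) + 1) - (real CARD('d) - 1) * \<kappa> * z\<^sup>2"
    by (auto elim: eventually_mono)
qed

section \<open>Taylor coefficients at the horizon\<close>

lemma leibniz_simps:
  "leibniz D E 0 z = D 0 z * E 0 z"
  "leibniz D E (Suc 0) z = D 0 z * E 1 z + D 1 z * E 0 z"
  "leibniz D E 2 z = D 0 z * E 2 z + 2 * D 1 z * E 1 z + D 2 z * E 0 z"
  "leibniz D E 3 z = D 0 z * E 3 z + 3 * D 1 z * E 2 z + 3 * D 2 z * E 1 z + D 3 z * E 0 z"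
  "leibniz D E 4 z = D 0 z * E 4 z + 4 * D 1 z * E 3 z + 6 * D 2 z * E 2 z + 4 * D 3 z * E 1 z + D 4 z * E 0 z"
  by (simp_all add: leibniz_def eval_nat_numeral)

text \<open>Orders 0, 1, 2 of the linear equation at z = 1 determine the derivatives of f2
  recursively. Since f1 and f2 both vanish there, the Wronskian identity is trivial at orders 0 and
  1; orders 2 and 3 give the proportionality of the second and third derivatives.\<close>

lemma horizon_taylor_relations:
  fixes d :: real
  assumes D1: "deriv_tower U D1" and D2: "deriv_tower U D2" and U: "1 \<in> U"
    and horizon: "D1 0 1 = 0" "D2 0 1 = 0"
    and wronskian: "\<forall>\<^sub>F z in at_left 1. D1 1 z * D2 0 z = D1 0 z * D2 1 z"
    and ode: "\<forall>\<^sub>F z in at_left 1. z * D2 1 z = (d + 1) * D2 0 z - (d + 1) - (d - 1) * \<kappa> * z\<^sup>2"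
  shows "D2 1 1 = - (d + 1) - (d - 1) * \<kappa>"
    and "D2 2 1 = d * D2 1 1 - 2 * (d - 1) * \<kappa>"
    and "D2 3 1 = (d - 1) * D2 2 1 - 2 * (d - 1) * \<kappa>"
    and "D1 2 1 * D2 1 1 = D1 1 1 * D2 2 1"
    and "D1 3 1 * D2 1 1 = D1 1 1 * D2 3 1"
proof -
  note open_U = deriv_tower_open[OF D1]
  define I where "I = (\<lambda>k z :: real. if k = (0::nat) then z else if k = 1 then 1 else 0)"
  define P where "P = (\<lambda>k z. leibniz D1 (\<lambda>k. D2 (Suc k)) k z - leibniz (\<lambda>k. D1 (Suc k)) D2 k z)"
  \<comment> \<open>Nested differences and the factor 1 - d fit the closure rules for towers, which
    cover differences and scalar multiples; \<open>leibniz I I\<close> is the tower of z^2.\<close>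
  define Q where "Q = (\<lambda>k z. leibniz I (\<lambda>k. D2 (Suc k)) k z -
    ((d + 1) * D2 k z - ((if k = 0 then d + 1 else 0) - (1 - d) * \<kappa> * leibniz I I k z)))"
  have I: "deriv_tower U I" unfolding I_def by (rule deriv_tower_ident[OF open_U])
  have "deriv_tower U P" unfolding P_def
    by (intro deriv_tower_diff deriv_tower_leibniz deriv_tower_shift D1 D2)
  moreover have "\<forall>\<^sub>F z in at_left 1. P 0 z = 0"
    using wronskian by eventually_elim (simp add: P_def leibniz_simps)
  ultimately have P: "P k 1 = 0" for k using U by (intro deriv_tower_vanish)
  have "deriv_tower U Q" unfolding Q_def
    by (intro deriv_tower_diff deriv_tower_leibniz deriv_tower_shift deriv_tower_cmult deriv_tower_const I D2 open_U)
  moreover have "\<forall>\<^sub>F z in at_left 1. Q 0 z = 0"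
    using ode by eventually_elim (simp add: Q_def I_def leibniz_simps power2_eq_square algebra_simps)
  ultimately have Q: "Q k 1 = 0" for k using U by (intro deriv_tower_vanish)
  show q1: "D2 1 1 = - (d + 1) - (d - 1) * \<kappa>"
    and "D2 2 1 = d * D2 1 1 - 2 * (d - 1) * \<kappa>"
    and "D2 3 1 = (d - 1) * D2 2 1 - 2 * (d - 1) * \<kappa>"
    using Q[of 0] Q[of 1] Q[of 2]
    by (simp_all add: Q_def I_def leibniz_simps horizon algebra_simps flip: numeral_2_eq_2 numeral_3_eq_3)
  show p2: "D1 2 1 * D2 1 1 = D1 1 1 * D2 2 1"
    using P[of 2] by (simp add: P_def leibniz_simps horizon algebra_simps flip: numeral_2_eq_2 numeral_3_eq_3)
  show "D1 3 1 * D2 1 1 = D1 1 1 * D2 3 1"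
    using P[of 3] p2 by (simp add: P_def leibniz_simps horizon algebra_simps flip: numeral_2_eq_2 numeral_3_eq_3)
qed

text \<open>A has a double zero, so its expansion starts at A_2. The B_j follow from B = A'/2 -
  (d/z) A and 1/z = 1 - (z-1) + (z-1)^2 - ..., which is where the difference A_3 - A_2 in B_3 comes
  from.\<close>

lemma horizon_coeff_scalar:
  fixes f1 f2 :: "real \<Rightarrow> real" and d :: nat and a2 a3 a4 :: real
  assumes D1: "deriv_tower U D1" "D1 0 = f1" and D2: "deriv_tower U D2" "D2 0 = f2"
    and U: "1 \<in> U" "0 \<notin> U"
    and horizon: "f1 1 = 0" "f2 1 = 0"
  defines "a2 \<equiv> D1 1 1 * D2 1 1"
    and "a3 \<equiv> (D1 1 1 * D2 2 1 + D1 2 1 * D2 1 1) / 2"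
    and "a4 \<equiv> (2 * D1 1 1 * D2 3 1 + 3 * D1 2 1 * D2 2 1 + 2 * D1 3 1 * D2 1 1) / 12"
  shows "horizon_coeff (scalar_A f1 f2) 2 = of_real a2"
    and "horizon_coeff (scalar_A f1 f2) 3 = of_real a3"
    and "horizon_coeff (scalar_A f1 f2) 4 = of_real a4"
    and "horizon_coeff (scalar_B d f1 f2) 1 = of_real a2"
    and "horizon_coeff (scalar_B d f1 f2) 2 = of_real (3 / 2 * a3 - d * a2)"
    and "horizon_coeff (scalar_B d f1 f2) 3 = of_real (2 * a4 - d * (a3 - a2))"
    and "horizon_coeff (scalar_C f1 \<omega> \<mu>) 0 = \<omega>\<^sup>2"
    and "horizon_coeff (scalar_C f1 \<omega> \<mu>) 1 = - \<mu> * of_real (D1 1 1)"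
    and "horizon_coeff (scalar_C f1 \<omega> \<mu>) 2 = - \<mu> * of_real (D1 2 1 / 2)"
proof -
  have z: "D1 0 1 = 0" "D2 0 1 = 0" using assms by auto
  note open_U = deriv_tower_open[OF D1(1)]
  let ?A = "leibniz D1 D2"
  let ?I = "\<lambda>k z :: real. (- 1) ^ k * fact k * inverse z ^ Suc k"
  let ?B = "\<lambda>k z. 1 / 2 * ?A (Suc k) z - d * leibniz ?I ?A k z"
  have A: "deriv_tower U ?A" by (rule deriv_tower_leibniz[OF D1(1) D2(1)])
  have B: "deriv_tower U ?B"
    by (intro deriv_tower_diff deriv_tower_cmult deriv_tower_shift deriv_tower_leibniz
        deriv_tower_inverse D1 D2 U open_U)
  have a: "?A 2 1 / fact 2 = a2" "?A 3 1 / fact 3 = a3" "?A 4 1 / fact 4 = a4"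
    by (simp_all add: leibniz_def a2_def a3_def a4_def z eval_nat_numeral field_simps)
  have b: "?B 1 1 / fact 1 = a2" "?B 2 1 / fact 2 = 3 / 2 * a3 - d * a2"
      "?B 3 1 / fact 3 = 2 * a4 - d * (a3 - a2)"
    by (simp_all add: leibniz_def a2_def a3_def a4_def z eval_nat_numeral field_simps)
  have "horizon_coeff (scalar_A f1 f2) (int k) = (if k = 0 then 0 else 0) + 1 * of_real (?A k 1 / fact k)" for k
    by (rule horizon_coeff_deriv_tower[OF A U(1)]) (simp add: scalar_A_def leibniz_simps D1 D2)
  from this[of 2] this[of 3] this[of 4]
  show "horizon_coeff (scalar_A f1 f2) 2 = of_real a2"
    and "horizon_coeff (scalar_A f1 f2) 3 = of_real a3"
    and "horizon_coeff (scalar_A f1 f2) 4 = of_real a4"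
    unfolding a by simp_all
  have "deriv (\<lambda>y. f1 y * f2 y) w = ?A 1 w" if "w \<in> U" for w
    using deriv_towerD[OF A that, of 0]
    by (intro DERIV_imp_deriv) (simp add: leibniz_def[abs_def] D1 D2)
  then have B0: "scalar_B d f1 f2 w = 0 + 1 * of_real (?B 0 w)" if "w \<in> U" for w
    using that unfolding scalar_B_def by (simp add: leibniz_simps(1) D1(2) D2(2) field_simps)
  have "horizon_coeff (scalar_B d f1 f2) (int k) = (if k = 0 then 0 else 0) + 1 * of_real (?B k 1 / fact k)" for k
    by (rule horizon_coeff_deriv_tower[OF B U(1) B0])
  from this[of 1] this[of 2] this[of 3]
  show "horizon_coeff (scalar_B d f1 f2) 1 = of_real a2"
    and "horizon_coeff (scalar_B d f1 f2) 2 = of_real (3 / 2 * a3 - d * a2)"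
    and "horizon_coeff (scalar_B d f1 f2) 3 = of_real (2 * a4 - d * (a3 - a2))"
    unfolding b by simp_all
  have "horizon_coeff (scalar_C f1 \<omega> \<mu>) (int k) = (if k = 0 then \<omega>\<^sup>2 else 0) + (- \<mu>) * of_real (D1 k 1 / fact k)" for k
    by (rule horizon_coeff_deriv_tower[OF D1(1) U(1)]) (simp add: scalar_C_def D1)
  from this[of 0] this[of 1] this[of 2]
  show "horizon_coeff (scalar_C f1 \<omega> \<mu>) 0 = \<omega>\<^sup>2"
    and "horizon_coeff (scalar_C f1 \<omega> \<mu>) 1 = - \<mu> * of_real (D1 1 1)"
    and "horizon_coeff (scalar_C f1 \<omega> \<mu>) 2 = - \<mu> * of_real (D1 2 1 / 2)"
    by (simp_all add: z fact_numeral)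
qed

section \<open>Pole-skipping determinants\<close>

lemma sum_count_mult:
  fixes M :: "'a::comm_ring_1 multiset"
  assumes "finite A" "set_mset M \<subseteq> A"
  shows "(\<Sum>x\<in>A. of_nat (count M x) * x) = sum_mset M"
  using assms(2)
proof (induction M)
  case (add y M)
  have "(\<Sum>x\<in>A. of_nat (count (add_mset y M) x) * x)
      = (\<Sum>x\<in>A. (if x = y then y else 0) + of_nat (count M x) * x)"
    by (rule sum.cong) (auto simp: algebra_simps)
  also have "\<dots> = y + sum_mset M"
    using add assms(1) by (simp add: sum.distrib)
  finally show ?case by simp
qed simp

lemma finite_mset_tags: "finite {(x, i). i < count M x}"
  and card_mset_tags: "card {(x, i). i < count M x} = size M"
  and prod_mset_tags: "(\<Prod>(x, i)\<in>{(x, i). i < count M x}. x) = prod_mset M"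
  and sum_mset_tags: "(\<Sum>(x, i)\<in>{(x, i). i < count M x}. x) = sum_mset M"
  for M :: "'a::comm_ring_1 multiset"
proof -
  have eq: "{(x, i). i < count M x} = Sigma (set_mset M) (\<lambda>x. {..<count M x})"
    by (auto simp flip: count_greater_zero_iff)
  show "finite {(x, i). i < count M x}" by (simp add: eq)
  show "card {(x, i). i < count M x} = size M"
    by (simp add: eq size_multiset_overloaded_eq)
  show "(\<Prod>(x, i)\<in>{(x, i). i < count M x}. x) = prod_mset M"
    by (simp add: eq prod_mset_multiplicity flip: prod.Sigma)
  have "(\<Sum>(x, i)\<in>{(x, i). i < count M x}. x) = (\<Sum>x\<in>set_mset M. of_nat (count M x) * x)"
    by (simp add: eq flip: sum.Sigma)
  also have "\<dots> = sum_mset M"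
    by (rule sum_count_mult) auto
  finally show "(\<Sum>(x, i)\<in>{(x, i). i < count M x}. x) = sum_mset M" .
qed

lemma esym_1: "esym 1 M = sum_mset M"
proof -
  let ?T = "{(x, i). i < count M x}"
  have "{I. I \<subseteq> ?T \<and> card I = 1} = (\<lambda>t. {t}) ` ?T"
    by (auto simp: card_1_singleton_iff)
  then have "esym 1 M = (\<Sum>t\<in>?T. \<Prod>(x, i)\<in>{t}. x)"
    unfolding esym_def by (simp add: sum.reindex)
  then show ?thesis using sum_mset_tags[of M] by (simp add: case_prod_unfold)
qed

lemma esym_size: "esym (size M) M = prod_mset M"
proof -
  let ?T = "{(x, i). i < count M x}"
  have "{I. I \<subseteq> ?T \<and> card I = size M} = {?T}"
    using card_mset_tags[of M] finite_mset_tags[of M] card_subset_eq[of ?T] by auto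
  then show ?thesis unfolding esym_def using prod_mset_tags[of M] by simp
qed

text \<open>A complex polynomial is determined by its values, so any polynomial representing the
  determinant is the one selected by \<open>THE\<close>.\<close>

lemma ps_values_eqI:
  assumes "\<And>\<mu>. ps_determinant d f1 f2 T n \<mu> = poly p \<mu>"
  shows "ps_values d f1 f2 T n = proots p"
proof -
  have "ps_polynomial d f1 f2 T n = p"
    unfolding ps_polynomial_def assms
    by (rule the_equality) (auto simp: poly_eq_poly_eq_iff fun_eq_iff[symmetric])
  then show ?thesis by (simp add: ps_values_def)
qed

lemma esym_proots_linear:
  fixes a b :: complex
  assumes "b \<noteq> 0"
  shows "esym 1 (proots [:a, b:]) = - a / b"
proof -
  have "[:a, b:] = Polynomial.smult b [:a / b, 1:]" using assms by simp
  then have "proots [:a, b:] = {#- (a / b)#}"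
    by (metis proots_smult[OF assms] proots_linear_factor)
  then show ?thesis unfolding esym_1 by simp
qed

text \<open>By the fundamental theorem of algebra there are two roots with multiplicity, u = v being
  allowed; comparing coefficients in c (X - u) (X - v) gives both formulas.\<close>

lemma esym_proots_quadratic:
  fixes a b c :: complex
  assumes "c \<noteq> 0"
  shows "esym 1 (proots [:a, b, c:]) = - b / c" "esym 2 (proots [:a, b, c:]) = a / c"
proof -
  let ?p = "[:a, b, c:]"
  have size: "size (proots ?p) = 2" using assms by (simp add: size_proots_complex)
  then obtain u v where uv: "proots ?p = {#u, v#}"
    by (metis One_nat_def Suc_inject numeral_2_eq_2 size_1_singleton_mset size_add_mset size_eq_Suc_imp_eq_union)
  have "Polynomial.smult (lead_coeff ?p) (\<Prod>x\<in>#proots ?p. [:- x, 1:]) = ?p"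
    by (rule complex_poly_decompose_multiset)
  then have "a = c * (u * v)" "b = - c * (u + v)"
    using assms by (simp_all add: uv algebra_simps)
  moreover have "esym 1 (proots ?p) = u + v" by (simp only: esym_1 uv) simp
  moreover have "esym 2 (proots ?p) = u * v"
    using esym_size[of "proots ?p"] by (simp only: size) (simp only: uv, simp)
  ultimately show "esym 1 (proots ?p) = - b / c" "esym 2 (proots ?p) = a / c"
    using assms by simp_all
qed

lemma det_mat_2:
  "Determinant.det (Matrix.mat 2 2 M) = M (0, 0) * M (1, 1) - M (0, 1) * (M (1, 0) :: 'a::comm_ring_1)"
proof -
  have "Determinant.det (Matrix.mat 2 2 M) =
      (\<Sum>j<2. Matrix.mat 2 2 M $$ (0, j) * cofactor (Matrix.mat 2 2 M) 0 j)"
    by (rule laplace_expansion_row) auto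
  then show ?thesis
    by (simp add: numeral_2_eq_2 cofactor_def mat_delete_def det_single)
qed

section \<open>The pole-skipping determinants of orders one and two\<close>

lemma ps_entry_at_frequency:
  assumes "T \<noteq> 0"
  shows "ps_entry d f1 f2 T (ps_frequency T n) \<mu> K S =
    horizon_coeff (scalar_A f1 f2) (int K - int S + 3)
      * (of_nat S - of_nat n / 2 - 1) * (of_nat S - of_nat n / 2 - 2)
    + horizon_coeff (scalar_B d f1 f2) (int K - int S + 2) * (of_nat S - of_nat n / 2 - 1)
    + horizon_coeff (scalar_C f1 (ps_frequency T n) \<mu>) (int K - int S + 1)"
proof -
  have e: "- \<i> * ps_frequency T n / of_real (4 * pi * T) = - of_nat n / 2"
    using assms by (simp add: ps_frequency_def field_simps)
  show ?thesis unfolding ps_entry_def Let_def e by (simp add: algebra_simps)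
qed

lemma ps_frequency_sq: "(ps_frequency T n)\<^sup>2 = - of_real ((2 * pi * T * n)\<^sup>2)"
  by (simp add: ps_frequency_def power_mult_distrib)

text \<open>Here \<rho> = -1/2, so the weights are \<rho> (\<rho> - 1) = 3/4 for A_3 and \<rho> for
  B_2.\<close>

lemma ps_determinant_1:
  assumes "T \<noteq> 0"
  shows "ps_determinant d f1 f2 T 1 \<mu> = 3 / 4 * horizon_coeff (scalar_A f1 f2) 3
    - 1 / 2 * horizon_coeff (scalar_B d f1 f2) 2 + horizon_coeff (scalar_C f1 (ps_frequency T 1) \<mu>) 1"
  unfolding ps_determinant_def
  by (subst det_single) (auto simp: ps_entry_at_frequency[OF assms])

text \<open>Here \<rho> = -1, so \<rho> + S - 1 vanishes in the column S = 2, leaving there only C_0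
  and C_1; in the column S = 1 the weights of A and B are 2 and -1.\<close>

lemma ps_determinant_2:
  assumes "T \<noteq> 0"
  shows "ps_determinant d f1 f2 T 2 \<mu> =
    (2 * horizon_coeff (scalar_A f1 f2) 3 - horizon_coeff (scalar_B d f1 f2) 2
      + horizon_coeff (scalar_C f1 (ps_frequency T 2) \<mu>) 1) * horizon_coeff (scalar_C f1 (ps_frequency T 2) \<mu>) 1
    - horizon_coeff (scalar_C f1 (ps_frequency T 2) \<mu>) 0
      * (2 * horizon_coeff (scalar_A f1 f2) 4 - horizon_coeff (scalar_B d f1 f2) 3
          + horizon_coeff (scalar_C f1 (ps_frequency T 2) \<mu>) 2)"
  unfolding ps_determinant_def det_mat_2
  by (simp add: ps_entry_at_frequency[OF assms] algebra_simps)

theorem mainTheorem5: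
  fixes f1 f2 :: "real \<Rightarrow> real" and \<kappa> T :: real and d :: nat
  assumes d: "d = CARD('d::finite)"
    and kappa: "\<kappa> \<in> {0, 1, -1}"
    and analytic: "real_analytic_at f1 1" "real_analytic_at f2 1"
    and horizon: "f1 1 = 0" "f2 1 = 0"
    and T_pos: "T > 0"
    and hawking: "deriv f1 1 * deriv f2 1 = (4 * pi * T)\<^sup>2"
    and einstein: "\<forall>\<^sub>F z in at_left 1. \<forall>x :: real^('d coord).
      x $ Radial = z \<longrightarrow> transverse x \<in> sigma_chart \<kappa> \<longrightarrow>
      vacuum_einstein_at (bh_metric \<kappa> f1 f2) (- (real d * (real d + 1) / 2)) x"
  shows "esym 1 (ps_values d f1 f2 T 1) =
         of_real (- (real d / 2) * (1 + real d + (real d - 1) * \<kappa>))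
       \<and> esym 1 (ps_values d f1 f2 T 2) =
         of_real (- 2 * (real d + 1) * (real d - \<kappa> + real d * \<kappa>))
       \<and> esym 2 (ps_values d f1 f2 T 2) =
         of_real (real d * ((real d)\<^sup>2 - 1) * (1 + \<kappa>) * (1 + real d - \<kappa> + real d * \<kappa>))"
proof -
  obtain r1 D1 where D1: "r1 > 0" "deriv_tower (ball 1 r1) D1" "D1 0 = f1"
    using real_analytic_at_imp_deriv_tower[OF analytic(1)] by metis
  obtain r2 D2 where D2: "r2 > 0" "deriv_tower (ball 1 r2) D2" "D2 0 = f2"
    using real_analytic_at_imp_deriv_tower[OF analytic(2)] by metis
  \<comment> \<open>Radius at most 1 excludes z = 0, where the factor 1/z in B is singular.\<close>
  define U where "U = ball (1::real) (min 1 (min r1 r2))"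
  have U: "1 \<in> U" "0 \<notin> U" using D1(1) D2(1) by (auto simp: U_def)
  have T1: "deriv_tower U D1" and T2: "deriv_tower U D2"
    unfolding U_def
    by (rule deriv_tower_subset[OF D1(2)] deriv_tower_subset[OF D2(2)]; simp add: subset_ball)+
  define p1 p2 p3 q1 q2 q3 where
    "p1 = D1 1 1" and "p2 = D1 2 1" and "p3 = D1 3 1" and "q1 = D2 1 1" and "q2 = D2 2 1" and "q3 = D2 3 1"
  note pq = p1_def[symmetric] p2_def[symmetric] p3_def[symmetric]
    q1_def[symmetric] q2_def[symmetric] q3_def[symmetric]
  have "deriv f1 1 = p1" "deriv f2 1 = q1"
    using deriv_towerD[OF T1 U(1), of 0] deriv_towerD[OF T2 U(1), of 0] D1(3) D2(3)
    by (auto intro!: DERIV_imp_deriv simp: p1_def q1_def)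
  then have T: "(4 * pi * T)\<^sup>2 = p1 * q1" using hawking by simp
  then have nz: "p1 \<noteq> 0" "q1 \<noteq> 0" using T_pos by auto
  have z: "D1 0 1 = 0" "D2 0 1 = 0" using horizon D1 D2 by auto
  have "D1 1 1 \<noteq> 0" "D2 1 1 \<noteq> 0" using nz by (simp_all add: p1_def q1_def)
  note ode = vacuum_einstein_bh_ode_at_left[OF T1 D1(3) T2 D2(3) U horizon this einstein[unfolded d]]
  note rel = horizon_taylor_relations[OF T1 T2 U(1) z ode, unfolded pq, folded d]
  \<comment> \<open>The normalisation of the time coordinate; the proportionality of f1 and f2 is
    recorded on derivatives at z = 1 only.\<close>
  define c where "c = p1 / q1"
  have p: "p1 = c * q1" "p2 = c * q2" "p3 = c * q3"
    using rel(4,5) nz by (simp_all add: c_def field_simps)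
  have c: "c \<noteq> 0" using nz by (simp add: c_def)
  note coeff = horizon_coeff_scalar[OF T1 D1(3) T2 D2(3) U horizon, unfolded pq]
  have "T \<noteq> 0" using T_pos by simp

  \<comment> \<open>As B_2 = 3/2 A_3 - d A_2, the A_3 terms cancel; d A_2 / 2 - \<mu>
    \<open>p1\<close> remains, with A_2 = \<open>p1 * q1\<close>.\<close>
  have "ps_determinant d f1 f2 T 1 \<mu> = poly [:of_real (d * c * q1\<^sup>2 / 2), - of_real (c * q1):] \<mu>" for \<mu>
    unfolding ps_determinant_1[OF \<open>T \<noteq> 0\<close>] coeff p
    by (simp add: field_simps power2_eq_square)
  note val1 = ps_values_eqI[OF this]
  have "esym 1 (ps_values d f1 f2 T 1) = of_real (d * q1 / 2)"
    unfolding val1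
    by (subst esym_proots_linear) (use c nz in \<open>simp_all add: field_simps power2_eq_square\<close>)
  then have 1: "esym 1 (ps_values d f1 f2 T 1) =
      of_real (- (real d / 2) * (1 + real d + (real d - 1) * \<kappa>))"
    unfolding rel(1) by (simp add: algebra_simps)

  \<comment> \<open>The constant and linear coefficients of the order-2 determinant, from A_2 = c
    q1^2 and A_3 = c q1 q2. In its lower left entry A_4 cancels, because B_3 = 2 A_4 - d (A_3 -
    A_2).\<close>
  define a0 a1 where "a0 = d * c * q1\<^sup>2 * (c * q1 * q2 - c * q1\<^sup>2)"
    and "a1 = c\<^sup>2 * q1\<^sup>2 * (- q2 - d * q1)"
  \<comment> \<open>For n = 2, omega^2 = - (4 pi T)^2, which is exactly minus the product of the two
    horizon slopes.\<close>
  have freq: "(ps_frequency T 2)\<^sup>2 = - of_real (c * q1\<^sup>2)"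
    using T unfolding ps_frequency_sq p by (simp add: power2_eq_square algebra_simps flip: of_real_mult)
  have "ps_determinant d f1 f2 T 2 \<mu> = poly [:of_real a0, of_real a1, of_real ((c * q1)\<^sup>2):] \<mu>" for \<mu>
    unfolding ps_determinant_2[OF \<open>T \<noteq> 0\<close>] coeff freq p a0_def a1_def
    by (simp add: field_simps power2_eq_square)
  note val2 = ps_values_eqI[OF this]
  have "of_real ((c * q1)\<^sup>2) \<noteq> (0 :: complex)" using c nz by simp
  note e2 = esym_proots_quadratic[OF this]
  have "esym 1 (ps_values d f1 f2 T 2) = of_real (- a1 / (c * q1)\<^sup>2)"
    unfolding val2 e2 by simp
  also have "- a1 / (c * q1)\<^sup>2 = q2 + d * q1"
    using c nz by (simp add: a1_def field_simps)
  also have "\<dots> = - 2 * (real d + 1) * (real d - \<kappa> + real d * \<kappa>)"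
    unfolding rel(2) rel(1) by (simp add: algebra_simps)
  finally have 2: "esym 1 (ps_values d f1 f2 T 2) =
      of_real (- 2 * (real d + 1) * (real d - \<kappa> + real d * \<kappa>))" .
  have "esym 2 (ps_values d f1 f2 T 2) = of_real (a0 / (c * q1)\<^sup>2)"
    unfolding val2 e2 by simp
  also have "a0 / (c * q1)\<^sup>2 = d * q1 * (q2 - q1)"
    using c nz by (simp add: a0_def field_simps power2_eq_square)
  also have "\<dots> = real d * ((real d)\<^sup>2 - 1) * (1 + \<kappa>) * (1 + real d - \<kappa> + real d * \<kappa>)"
    unfolding rel(2) rel(1) by (simp add: algebra_simps power2_eq_square)
  finally show ?thesis using 1 2 by blast
qed

end
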